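(* Let $L$ be a Lie algebra (not necessarily finite dimensional) over a field $F$, let $I$ be a solvable ideal of $L$ of derived length $n$, and let $D\in \mathrm{Der}(L)$ be a derivation of $L$. Suppose that one of the following holds: (1) $\mathrm{char}\, F=0$; (2) $\mathrm{char}\, F=p>0$ and $n<\log_2 p$. Then the ideal $I+D(I)$ of $L$ is solvable and its derived length is at most $2n$.
   Context: $\mathrm{Der}(L)$ is the set of all $F$-linear derivations $D:L\to L$, and $D(I)$ is the image of $I$ under $D$. For any ideal $I$ of $L$, the subspace $I+D(I)$ is an ideal of $L$. The derived series of a Lie algebra $M$ is $M^{(0)}=M$, $M^{(k)}=[M^{(k-1)},M^{(k-1)}]$, where brackets of subspaces denote linear spans. The derived length of a solvable Lie algebra $M$ is the least $k\ge 0$ with $M^{(k)}=0$; in particular it is $0$ if and only if $M=0$. *)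

theory Defs
  imports Complex_Main "HOL-Library.Set_Algebras"
begin

text \<open>A Lie algebra over the field \<open>'f\<close>, of arbitrary dimension; its underlying vector space is
  the type \<open>'a\<close> with scalar multiplication \<open>scale\<close>. Bilinearity is stated as linearity in each
  argument, and the alternating law (rather than antisymmetry) makes the definition correct in
  characteristic 2.\<close>

locale lie_algebra = vector_space scale
  for scale :: "'f::field \<Rightarrow> 'a::ab_group_add \<Rightarrow> 'a" +
  fixes bracket :: "'a \<Rightarrow> 'a \<Rightarrow> 'a"
  assumes linear_bracket_left: "Vector_Spaces.linear scale scale (\<lambda>x. bracket x y)"
    and linear_bracket_right: "Vector_Spaces.linear scale scale (bracket x)"
    and bracket_self: "bracket x x = 0"
    and jacobi: "bracket x (bracket y z) + bracket y (bracket z x) + bracket z (bracket x y) = 0"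
begin

definition lie_ideal :: "'a set \<Rightarrow> bool" where
  "lie_ideal I \<longleftrightarrow> subspace I \<and> (\<forall>x. \<forall>y\<in>I. bracket x y \<in> I)"

definition Der :: "('a \<Rightarrow> 'a) set" where
  "Der = {D. Vector_Spaces.linear scale scale D \<and>
    (\<forall>x y. D (bracket x y) = bracket (D x) y + bracket x (D y))}"

definition bracket_span :: "'a set \<Rightarrow> 'a set \<Rightarrow> 'a set" where
  "bracket_span A B = span {bracket x y | x y. x \<in> A \<and> y \<in> B}"

primrec derived_series :: "'a set \<Rightarrow> nat \<Rightarrow> 'a set" where
  "derived_series M 0 = M"
| "derived_series M (Suc k) = bracket_span (derived_series M k) (derived_series M k)"

definition lie_solvable :: "'a set \<Rightarrow> bool" where
  "lie_solvable M \<longleftrightarrow> (\<exists>k. derived_series M k = {0})"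

text \<open>Only meaningful for \<open>lie_solvable M\<close>.\<close>

definition derived_length :: "'a set \<Rightarrow> nat" where
  "derived_length M = (LEAST k. derived_series M k = {0})"

end

end

theory Submission
  imports Defs "HOL-Computational_Algebra.Primes"
begin

text \<open>Put \<open>J = I + D(I)\<close> and \<open>m = 2\<^sup>k\<close>. A bracket monomial in \<open>I\<^bsup>(k)\<^esup>\<close> has \<open>m\<close> entries, so
  applying \<open>D\<close> fewer than \<open>m\<close> times leaves some entry in \<open>I\<close> untouched, while in \<open>D\<^sup>m\<close> of it the
  only term without an untouched entry is \<open>m!\<close> times the monomial in the \<open>D\<close>-images. As \<open>m!\<close> is
  invertible for \<open>k \<le> n\<close>, this gives \<open>J\<^bsup>(k)\<^esup> \<subseteq> I + D\<^sup>m(I\<^bsup>(k)\<^esup>)\<close> by induction on \<open>k\<close>. For \<open>k = n\<close>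
  it says \<open>J\<^bsup>(n)\<^esup> \<subseteq> I\<close>, whence \<open>J\<^bsup>(2n)\<^esup> = 0\<close>.\<close>

section \<open>Binomial coefficients in the field\<close>

text \<open>The binomial coefficient divides \<open>fact n\<close>, and a prime larger than
  \<open>n\<close> does not. This is the only place where the characteristic matters.\<close>

lemma of_nat_choose_neq_0:
  assumes "CHAR('f::field) = 0 \<or> n < CHAR('f)" and "k \<le> n"
  shows "(of_nat (n choose k) :: 'f) \<noteq> 0"
proof
  assume "(of_nat (n choose k) :: 'f) = 0"
  then have dvd: "CHAR('f) dvd (n choose k)"
    by (simp add: of_nat_eq_0_iff_char_dvd)
  \<comment> \<open>Characteristic 0 would give \<open>0 dvd (n choose k)\<close>, but this
    coefficient is positive.\<close>
  have pos: "CHAR('f) > 0"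
    using dvd assms(2) by (cases "CHAR('f) = 0") auto
  then have "prime CHAR('f)"
    by (rule prime_CHAR_semidom)
  moreover have "CHAR('f) dvd fact n"
    using dvd binomial_fact_lemma[OF assms(2)] by (metis dvd_mult dvd_trans dvd_triv_right)
  ultimately show False
    using assms(1) pos by (simp add: prime_dvd_fact_iff)
qed

context lie_algebra
begin

interpretation endo: vector_space_pair scale scale
  by unfold_locales

section \<open>Bracket identities and the Leibniz rule\<close>

lemma bracket_linear_simps:
  "bracket (x + y) z = bracket x z + bracket y z"
  "bracket x (y + z) = bracket x y + bracket x z"
  "bracket (scale c x) y = scale c (bracket x y)"
  "bracket x (scale c y) = scale c (bracket x y)"
  using linear_bracket_left linear_bracket_right
  by (simp_all add: Vector_Spaces.linear_iff)

lemma bracket_antisym: "bracket x y = - bracket y x"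
proof -
  have "0 = bracket (x + y) (x + y)"
    by (simp add: bracket_self)
  also have "\<dots> = bracket x x + bracket y x + (bracket x y + bracket y y)"
    by (simp only: bracket_linear_simps)
  also have "\<dots> = bracket x y + bracket y x"
    by (simp add: bracket_self)
  finally show ?thesis
    by (simp add: eq_neg_iff_add_eq_0)
qed

lemma lie_ideal_bracket_left: "lie_ideal I \<Longrightarrow> x \<in> I \<Longrightarrow> bracket x y \<in> I"
  by (subst bracket_antisym) (simp add: lie_ideal_def subspace_neg)

lemma linear_funpow:
  assumes "Vector_Spaces.linear scale scale D"
  shows "Vector_Spaces.linear scale scale (D ^^ j)"
proof (induction j)
  case 0
  then show ?case by (simp add: Vector_Spaces.linear_iff vector_space_axioms)
next
  case (Suc j)
  then show ?case
    unfolding funpow.simps using assms by (rule Vector_Spaces.linear_compose)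
qed

text \<open>Leibniz rule, proved like the binomial theorem: one more \<open>D\<close> raises either
  the left or the right exponent, and Pascal's rule collects the terms.\<close>

lemma Der_funpow_bracket:
  assumes "D \<in> Der"
  shows "(D ^^ n) (bracket x y) =
    (\<Sum>i\<le>n. scale (of_nat (n choose i)) (bracket ((D ^^ i) x) ((D ^^ (n - i)) y)))"
proof (induction n)
  case 0
  then show ?case by simp
next
  case (Suc n)
  define T where "T i j = bracket ((D ^^ i) x) ((D ^^ j) y)" for i j
  define c :: "nat \<Rightarrow> nat \<Rightarrow> 'f" where "c n i = of_nat (n choose i)" for n i
  have lin: "Vector_Spaces.linear scale scale D"
    using assms by (simp add: Der_def)
  have DT: "D (T i j) = T (Suc i) j + T i (Suc j)" for i j
    using assms by (simp add: Der_def T_def)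
  have "(D ^^ Suc n) (bracket x y) = D (\<Sum>i\<le>n. scale (c n i) (T i (n - i)))"
    using Suc.IH by (simp add: T_def c_def)
  also have "\<dots> = (\<Sum>i\<le>n. scale (c n i) (T (Suc i) (n - i) + T i (Suc (n - i))))"
    by (simp add: endo.linear_sum[OF lin] endo.linear_scale[OF lin] DT)
  also have "\<dots> = (\<Sum>i\<le>n. scale (c n i) (T (Suc i) (n - i)))
      + (\<Sum>i\<le>n. scale (c n i) (T i (Suc n - i)))"
    by (simp add: scale_right_distrib sum.distrib Suc_diff_le)
  \<comment> \<open>The added term \<open>i = Suc n\<close> vanishes because
    \<open>n choose Suc n = 0\<close>.\<close>
  also have "(\<Sum>i\<le>n. scale (c n i) (T i (Suc n - i)))
      = (\<Sum>i\<le>Suc n. scale (c n i) (T i (Suc n - i)))"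
    by (simp add: c_def binomial_eq_0)
  also have "\<dots> = scale (c n 0) (T 0 (Suc n))
      + (\<Sum>i\<le>n. scale (c n (Suc i)) (T (Suc i) (n - i)))"
    by (subst sum.atMost_Suc_shift) simp
  also have "(\<Sum>i\<le>n. scale (c n i) (T (Suc i) (n - i))) + \<dots> = scale (c (Suc n) 0) (T 0 (Suc n))
      + (\<Sum>i\<le>n. scale (c (Suc n) (Suc i)) (T (Suc i) (n - i)))"
    by (simp add: c_def scale_left_distrib sum.distrib)
  also have "\<dots> = (\<Sum>i\<le>Suc n. scale (c (Suc n) i) (T i (Suc n - i)))"
    by (subst sum.atMost_Suc_shift) simp
  finally show ?case by (simp only: T_def c_def)
qed

section \<open>Spans of brackets and derived series\<close>

lemma bracket_span_minimal:
  assumes "subspace S" and "\<And>x y. x \<in> A \<Longrightarrow> y \<in> B \<Longrightarrow> bracket x y \<in> S"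
  shows "bracket_span A B \<subseteq> S"
  unfolding bracket_span_def using assms by (intro span_minimal) auto

lemma bracket_span_mono: "A \<subseteq> A' \<Longrightarrow> B \<subseteq> B' \<Longrightarrow> bracket_span A B \<subseteq> bracket_span A' B'"
  unfolding bracket_span_def by (intro span_mono) blast

lemma bracket_in_derived_series:
  "x \<in> derived_series M k \<Longrightarrow> y \<in> derived_series M k \<Longrightarrow> bracket x y \<in> derived_series M (Suc k)"
  unfolding derived_series.simps bracket_span_def by (intro span_base) blast

lemma derived_series_mono: "M \<subseteq> N \<Longrightarrow> derived_series M k \<subseteq> derived_series N k"
  by (induction k) (simp_all add: bracket_span_mono)

lemma derived_series_add: "derived_series M (j + k) = derived_series (derived_series M j) k"
  by (induction k) simp_all

lemma subspace_derived_series: "subspace M \<Longrightarrow> subspace (derived_series M k)"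
  by (cases k) (simp_all add: bracket_span_def)

lemma subspace_vimage:
  assumes "Vector_Spaces.linear scale scale f" and "subspace S"
  shows "subspace {x. f x \<in> S}"
  using assms(2) endo.linear_0[OF assms(1)] endo.linear_add[OF assms(1)] endo.linear_scale[OF assms(1)]
  by (simp add: subspace_def)

lemma subspace_add_image:
  assumes "Vector_Spaces.linear scale scale f" and "subspace S" and "subspace T"
  shows "subspace (S + f ` T)"
proof -
  have "subspace {x + y | x y. x \<in> S \<and> y \<in> f ` T}"
    using assms by (intro subspace_sums endo.linear_subspace_image)
  moreover have "{x + y | x y. x \<in> S \<and> y \<in> f ` T} = S + f ` T"
    by (auto simp: set_plus_def)
  ultimately show ?thesis by simp
qed

section \<open>Iterated derivations on the derived series of an ideal\<close>

text \<open>The product rule rewrites \<open>bracket x (D b)\<close> as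
  \<open>D (bracket x b) - bracket (D x) b\<close>, with both brackets on the right in
  \<open>I\<close>.\<close>

lemma lie_ideal_add_Der_image:
  assumes "lie_ideal I" and "D \<in> Der"
  shows "lie_ideal (I + D ` I)"
  unfolding lie_ideal_def
proof (intro conjI allI ballI)
  have lin: "Vector_Spaces.linear scale scale D" and I: "subspace I"
    using assms by (auto simp: Der_def lie_ideal_def)
  then show "subspace (I + D ` I)"
    by (intro subspace_add_image)
  fix x y assume "y \<in> I + D ` I"
  then obtain a b where ab: "a \<in> I" "b \<in> I" "y = a + D b"
    by (auto elim: set_plus_elim)
  have "bracket x (D b) = D (bracket x b) - bracket (D x) b"
    using assms(2) by (simp add: Der_def)
  then have "bracket x y = (bracket x a - bracket (D x) b) + D (bracket x b)"
    by (simp add: ab bracket_linear_simps)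
  moreover have "bracket x a - bracket (D x) b \<in> I" "bracket x b \<in> I"
    using assms(1) ab I by (auto simp: lie_ideal_def intro: subspace_diff)
  ultimately show "bracket x y \<in> I + D ` I"
    by (auto intro: set_plus_intro)
qed

text \<open>In each Leibniz term the exponents \<open>i\<close> and \<open>j - i\<close> add up to
  less than \<open>2 * 2 ^ k\<close>, so one of them is below \<open>2 ^ k\<close>. By induction
  that factor lies in \<open>I\<close>, and the ideal absorbs the other one.\<close>

lemma Der_funpow_derived_series_subset:
  assumes "lie_ideal I" and "D \<in> Der" and "x \<in> derived_series I k" and "j < 2 ^ k"
  shows "(D ^^ j) x \<in> I"
  using assms(3,4)
proof (induction k arbitrary: x j)
  case 0
  then show ?case by simp
next
  case (Suc k)
  have I: "subspace I"
    using assms(1) by (simp add: lie_ideal_def)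
  \<comment> \<open>The preimage of \<open>I\<close> under \<open>D ^^ j\<close> is a subspace, so
    single brackets suffice.\<close>
  have "bracket_span (derived_series I k) (derived_series I k) \<subseteq> {x. (D ^^ j) x \<in> I}"
  proof (rule bracket_span_minimal)
    show "subspace {x. (D ^^ j) x \<in> I}"
      using assms(2) I by (intro subspace_vimage linear_funpow) (simp_all add: Der_def)
    fix x y assume xy: "x \<in> derived_series I k" "y \<in> derived_series I k"
    have "bracket ((D ^^ i) x) ((D ^^ (j - i)) y) \<in> I" if "i \<le> j" for i
    proof (cases "i < 2 ^ k")
      case True
      then show ?thesis
        using Suc.IH xy(1) assms(1) by (blast intro: lie_ideal_bracket_left)
    next
      case False
      then have "j - i < 2 ^ k"
        using Suc.prems(2) that by simp
      then show ?thesis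
        using Suc.IH xy(2) assms(1) by (auto simp: lie_ideal_def)
    qed
    then have "(D ^^ j) (bracket x y) \<in> I"
      unfolding Der_funpow_bracket[OF assms(2)]
      by (intro subspace_sum[OF I] subspace_scale[OF I]) simp
    then show "bracket x y \<in> {x. (D ^^ j) x \<in> I}" by simp
  qed
  then show ?case using Suc.prems(1) by auto
qed

text \<open>Every Leibniz term except the one with both exponents equal to \<open>m\<close> has an
  exponent below \<open>m\<close>, hence a factor in \<open>I\<close>.\<close>

lemma Der_funpow_bracket_middle:
  fixes k :: nat
  defines "m \<equiv> 2 ^ k"
  assumes "lie_ideal I" and "D \<in> Der" and "x \<in> derived_series I k" and "y \<in> derived_series I k"
  shows "(D ^^ (2 * m)) (bracket x y)
    - scale (of_nat (2 * m choose m)) (bracket ((D ^^ m) x) ((D ^^ m) y)) \<in> I"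
proof -
  have I: "subspace I"
    using assms(2) by (simp add: lie_ideal_def)
  let ?t = "\<lambda>i. scale (of_nat (2 * m choose i)) (bracket ((D ^^ i) x) ((D ^^ (2 * m - i)) y))"
  have "?t i \<in> I" if "i \<in> {..2 * m} - {m}" for i
  proof (cases "i < m")
    case True
    then have "(D ^^ i) x \<in> I"
      using Der_funpow_derived_series_subset assms by blast
    then show ?thesis
      using assms(2) by (intro subspace_scale[OF I] lie_ideal_bracket_left)
  next
    case False
    then have "2 * m - i < m"
      using that by auto
    then have "(D ^^ (2 * m - i)) y \<in> I"
      using Der_funpow_derived_series_subset assms by blast
    then show ?thesis
      using assms(2) by (intro subspace_scale[OF I]) (simp add: lie_ideal_def)
  qed
  then have "sum ?t ({..2 * m} - {m}) \<in> I"
    by (intro subspace_sum[OF I])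
  moreover have "(D ^^ (2 * m)) (bracket x y) = ?t m + sum ?t ({..2 * m} - {m})"
    unfolding Der_funpow_bracket[OF assms(3)] by (rule sum.remove) auto
  ultimately show ?thesis by simp
qed

text \<open>The step from \<open>k\<close> to \<open>Suc k\<close> doubles the exponent of
  \<open>D\<close> and divides only by the central binomial coefficient
  \<open>2 * m choose m\<close>. It is nonzero in the field since \<open>2 * m = 2 ^ Suc k\<close>
  is below a positive characteristic.\<close>

lemma derived_series_add_Der_image_subset:
  assumes "lie_ideal I" and "D \<in> Der" and "CHAR('f) = 0 \<or> 2 ^ k < CHAR('f)"
  shows "derived_series (I + D ` I) k \<subseteq> I + (D ^^ (2 ^ k)) ` derived_series I k"
  using assms(3)
proof (induction k)
  case 0
  then show ?case by simp
next
  case (Suc k)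
  define m :: nat where "m = 2 ^ k"
  define J where "J = derived_series (I + D ` I) k"
  define K where "K = I + (D ^^ (2 * m)) ` derived_series I (Suc k)"
  define c :: 'f where "c = of_nat (2 * m choose m)"
  have I: "subspace I"
    using assms(1) by (simp add: lie_ideal_def)
  have lin: "Vector_Spaces.linear scale scale (D ^^ j)" for j
    using assms(2) by (intro linear_funpow) (simp add: Der_def)
  have c: "c \<noteq> 0"
    unfolding c_def using Suc.prems by (intro of_nat_choose_neq_0) (auto simp: m_def)
  have K: "subspace K"
    unfolding K_def by (intro subspace_add_image lin I subspace_derived_series)
  have IK: "I \<subseteq> K"
  proof
    fix x assume "x \<in> I"
    moreover have "0 \<in> (D ^^ (2 * m)) ` derived_series I (Suc k)"
      using subspace_0[OF subspace_derived_series[OF I]] endo.linear_0[OF lin] by (metis image_eqI)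
    ultimately have "x + 0 \<in> K"
      unfolding K_def by (rule set_plus_intro)
    then show "x \<in> K" by simp
  qed
  have "CHAR('f) = 0 \<or> 2 ^ k < CHAR('f)"
    using Suc.prems by auto
  then have JK: "J \<subseteq> I + (D ^^ m) ` derived_series I k"
    unfolding J_def m_def by (rule Suc.IH)
  have "bracket_span J J \<subseteq> K"
  proof (rule bracket_span_minimal[OF K])
    fix u v assume "u \<in> J" "v \<in> J"
    then obtain a x b y
      where u: "a \<in> I" "x \<in> derived_series I k" "u = a + (D ^^ m) x"
        and v: "b \<in> I" "y \<in> derived_series I k" "v = b + (D ^^ m) y"
      using JK by (blast elim: set_plus_elim)
    define z where "z = bracket ((D ^^ m) x) ((D ^^ m) y)"
    define w where "w = (D ^^ (2 * m)) (bracket x y)"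
    have "w - scale c z \<in> K"
      unfolding w_def z_def c_def m_def
      using Der_funpow_bracket_middle[OF assms(1,2) u(2) v(2)] IK by blast
    moreover have "w \<in> K"
    proof -
      have "0 + w \<in> K"
        unfolding K_def w_def using u v I
        by (intro set_plus_intro imageI bracket_in_derived_series subspace_0)
      then show ?thesis by simp
    qed
    \<comment> \<open>Modulo \<open>I\<close>, \<open>w\<close> is \<open>scale c z\<close>;
      inverting \<open>c\<close> then puts the bracket \<open>z\<close> of the two images into
      \<open>K\<close>.\<close>
    ultimately have "w - (w - scale c z) \<in> K"
      by (rule subspace_diff[OF K, rotated])
    then have "scale c z \<in> K" by simp
    then have "scale (inverse c) (scale c z) \<in> K"
      by (rule subspace_scale[OF K])
    then have "z \<in> K"
      using c by simp
    moreover have "bracket a v \<in> K" "bracket ((D ^^ m) x) b \<in> K"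
      using lie_ideal_bracket_left[OF assms(1) u(1)] assms(1) v(1) IK
      by (auto simp: lie_ideal_def)
    \<comment> \<open>Grouping by \<open>a\<close> and \<open>b\<close> leaves \<open>z\<close> as
      the only summand not already in \<open>I\<close>.\<close>
    moreover have "bracket u v = bracket a v + (bracket ((D ^^ m) x) b + z)"
      by (simp add: u v z_def bracket_linear_simps)
    ultimately show "bracket u v \<in> K"
      by (simp add: subspace_add[OF K])
  qed
  then show ?case
    by (simp only: K_def J_def m_def derived_series.simps power_Suc)
qed

text \<open>At step \<open>n\<close> the image summand is the image of \<open>{0}\<close>, so the
  series has entered \<open>I\<close>; another \<open>n\<close> steps exhaust
  \<open>I\<close>.\<close>

lemma derived_series_add_Der_image_eq_0:
  assumes "lie_ideal I" and "D \<in> Der" and "CHAR('f) = 0 \<or> 2 ^ n < CHAR('f)"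
    and "derived_series I n = {0}"
  shows "derived_series (I + D ` I) (2 * n) = {0}"
proof -
  have lin: "Vector_Spaces.linear scale scale (D ^^ j)" for j
    using assms(2) by (intro linear_funpow) (simp add: Der_def)
  have "derived_series (I + D ` I) n \<subseteq> I"
    using derived_series_add_Der_image_subset[OF assms(1-3)]
    by (simp add: assms(4) endo.linear_0[OF lin])
  \<comment> \<open>Here \<open>{0}\<close> is read backwards as \<open>derived_series I n\<close>,
    so that monotonicity applies.\<close>
  then have "derived_series (I + D ` I) (n + n) \<subseteq> {0}"
    unfolding derived_series_add assms(4)[symmetric] by (rule derived_series_mono)
  moreover have "0 \<in> derived_series (I + D ` I) (n + n)"
    using lie_ideal_add_Der_image[OF assms(1,2)]
    by (intro subspace_0 subspace_derived_series) (simp add: lie_ideal_def)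
  ultimately show ?thesis by (auto simp: mult_2)
qed

end

theorem theorem1:
  fixes scale :: "'f::field \<Rightarrow> 'a::ab_group_add \<Rightarrow> 'a"
    and bracket :: "'a \<Rightarrow> 'a \<Rightarrow> 'a"
    and I :: "'a set" and D :: "'a \<Rightarrow> 'a" and n :: nat
  assumes "lie_algebra scale bracket"
    and "lie_algebra.lie_ideal scale bracket I"
    and "lie_algebra.lie_solvable scale bracket I"
    and "lie_algebra.derived_length scale bracket I = n"
    and "D \<in> lie_algebra.Der scale bracket"
    and "CHAR('f) = 0 \<or> (CHAR('f) > 0 \<and> real n < log 2 (real CHAR('f)))"
  shows "lie_algebra.lie_ideal scale bracket (I + D ` I)
    \<and> lie_algebra.lie_solvable scale bracket (I + D ` I)
    \<and> lie_algebra.derived_length scale bracket (I + D ` I) \<le> 2 * n"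
proof -
  interpret lie_algebra scale bracket by fact
  \<comment> \<open>Solvability makes the \<open>LEAST\<close> defining the derived length an
    attained value.\<close>
  have "derived_series I n = {0}"
    using assms(3,4) unfolding lie_solvable_def derived_length_def by (metis (mono_tags) LeastI_ex)
  moreover have "CHAR('f) = 0 \<or> 2 ^ n < CHAR('f)"
  proof (cases "CHAR('f) = 0")
    case False
    then have "2 powr real n < real CHAR('f)"
      using assms(6) by (simp add: less_log_iff)
    then have "real (2 ^ n) < real CHAR('f)"
      by (simp add: powr_realpow)
    then show ?thesis by (auto simp only: of_nat_less_iff)
  qed simp
  ultimately have "derived_series (I + D ` I) (2 * n) = {0}"
    using assms(2,5) by (intro derived_series_add_Der_image_eq_0)
  then show ?thesis
    using lie_ideal_add_Der_image[OF assms(2,5)]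
    by (auto simp: lie_solvable_def derived_length_def intro: Least_le)
qed

end
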